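(* Let $\{\mathbf{x}^{k}\}$ be a sequence generated by the algorithm FBi-PG (defined in the context, with $t_k=(k+a)/a$ for $k\ge 0$ and an integer $a\ge 2$) with $\gamma=1$. For $k\ge 1$ let $\bar{\mathbf{x}}^{k}=\frac1k\sum_{s=1}^{k}\mathbf{x}^{s}$ and let $\tilde{\mathbf{x}}^{k}\in\operatorname{arg\,min}\{\omega(\mathbf{x}):\mathbf{x}\in\{\mathbf{x}^{k},\bar{\mathbf{x}}^{k}\}\}$. Then for all integers $k\ge 1$ and all $\mathbf{x}'\in X'$, $$\varphi(\tilde{\mathbf{x}}^{k})-\varphi(\mathbf{x}')\le \frac{\pi^{2}a^{2}\beta}{12k}\|\mathbf{x}^{0}-\mathbf{x}'\|^{2}+\frac{a^{2}\ln(k+1)}{k}\bigl(\omega(\mathbf{x}')-\omega^{\ast}\bigr)$$ and $$\omega(\tilde{\mathbf{x}}^{k})-\omega(\mathbf{x}')\le \frac{a^{2}\beta}{2(k+1)}\|\mathbf{x}^{0}-\mathbf{x}'\|^{2}.$$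
   Context: Bi-level problem: the inner problem is $\min_{\mathbf{x}\in\mathbb{R}^n}\{\varphi(\mathbf{x}):=f(\mathbf{x})+g(\mathbf{x})\}$ with solution set $X^{\ast}$; the outer problem is $\min_{\mathbf{x}\in X^{\ast}}\{\omega(\mathbf{x}):=\sigma(\mathbf{x})+\psi(\mathbf{x})\}$, and $X'\subset X^{\ast}$ is the set of its optimal solutions (minimizers of $\omega$ over $X^\ast$, at which $\omega$ is finite). Standing assumptions: (i) $f,\sigma:\mathbb{R}^n\to\mathbb{R}$ are convex and continuously differentiable with Lipschitz continuous gradients with constants $\beta_f,\beta_\sigma$, and $\beta:=\beta_f+\beta_\sigma>0$; (ii) $g,\psi:\mathbb{R}^n\to(-\infty,\infty]$ are proper, lower semicontinuous and convex; (iii) $X^{\ast}\ne\emptyset$; (iv) $\omega^{\ast}:=\inf_{\mathbf{x}\in\mathbb{R}^n}\omega(\mathbf{x})>-\infty$. Norms are Euclidean. Algorithm FBi-PG: input $\gamma>0$ and an integer $a\ge 2$. Set $\alpha_{-1}=t_{-1}=0$, $\mathbf{x}^{0}=\mathbf{x}^{-1}\in\mathbb{R}^n$ arbitrary, and for $k\ge0$ let $\alpha_k=(k+a)^{-\gamma}$, $t_k=(k+a)/a$, $f_k=f+\alpha_k\sigma$, $g_k=g+\alpha_k\psi$. For $k=0,1,2,\ldots$: $$\mathbf{y}^{k}=\mathbf{x}^{k}+t_k^{-1}(t_{k-1}-1)(\mathbf{x}^{k}-\mathbf{x}^{k-1}),\qquad \mathbf{x}^{k+1}=\operatorname*{arg\,min}_{\mathbf{x}\in\mathbb{R}^n}\Bigl\{g_k(\mathbf{x})+\mathbf{x}^{T}\nabla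 f_k(\mathbf{y}^{k})+\tfrac{\beta}{2}\|\mathbf{x}-\mathbf{y}^{k}\|^{2}\Bigr\}.$$ *)

theory Defs
  imports "HOL-Analysis.Analysis"
begin

definition grad :: "('a::real_inner \<Rightarrow> real) \<Rightarrow> 'a \<Rightarrow> 'a" where
  "grad f x = (THE D. GDERIV f x :> D)"

lemma grad_eqI:
  assumes "GDERIV f x :> D"
  shows "grad f x = D"
  unfolding grad_def
proof (rule the_equality)
  fix D' assume "GDERIV f x :> D'"
  then have "(\<lambda>h. h \<bullet> D') = (\<lambda>h. h \<bullet> D)"
    using assms unfolding gderiv_def by (rule has_derivative_unique)
  then have "\<forall>h. h \<bullet> D' = h \<bullet> D"
    by (simp add: fun_eq_iff)
  then show "D' = D"
    by (simp only: vector_eq_ldot)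
qed (rule assms)

lemma GDERIV_grad:
  fixes f :: "'a::euclidean_space \<Rightarrow> real"
  assumes "f differentiable (at x)"
  shows "GDERIV f x :> grad f x"
proof -
  obtain f' where f': "(f has_derivative f') (at x)"
    using assms by (auto simp: differentiable_def)
  then have "linear f'"
    by (rule has_derivative_linear)
  then have "f' = (\<lambda>h. h \<bullet> adjoint f' 1)"
    by (simp add: fun_eq_iff adjoint_works)
  with f' have "GDERIV f x :> adjoint f' 1"
    unfolding gderiv_def by simp
  then show ?thesis
    by (simp add: grad_eqI)
qed

definition smooth_with :: "real \<Rightarrow> ('a::euclidean_space \<Rightarrow> real) \<Rightarrow> bool" where
  "smooth_with L f \<longleftrightarrow>
     (\<forall>x. f differentiable (at x)) \<and> continuous_on UNIV (grad f) \<and> L-lipschitz_on UNIV (grad f)"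

definition proper_fun :: "('a \<Rightarrow> ereal) \<Rightarrow> bool" where
  "proper_fun g \<longleftrightarrow> (\<forall>x. g x \<noteq> - \<infinity>) \<and> (\<exists>x. g x \<noteq> \<infinity>)"

definition lsc_fun :: "('a::topological_space \<Rightarrow> ereal) \<Rightarrow> bool" where
  "lsc_fun g \<longleftrightarrow> (\<forall>x. g x \<le> Liminf (at x) g)"

text \<open>Only used for functions that never take the value \<open>- \<infinity>\<close>, so that no sum of opposite
  infinities occurs on the right-hand side; also \<open>0 * \<infinity> = 0\<close> in \<^typ>\<open>ereal\<close>.\<close>

definition convex_fun :: "('a::real_vector \<Rightarrow> ereal) \<Rightarrow> bool" where
  "convex_fun g \<longleftrightarrow>
     (\<forall>x y. \<forall>u\<ge>0. \<forall>v\<ge>0. u + v = 1 \<longrightarrow> g (u *\<^sub>R x + v *\<^sub>R y) \<le> ereal u * g x + ereal v * g y)"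

definition composite :: "('a \<Rightarrow> real) \<Rightarrow> ('a \<Rightarrow> ereal) \<Rightarrow> 'a \<Rightarrow> ereal" where
  "composite f g x = ereal (f x) + g x"

definition inner_solutions :: "('a \<Rightarrow> ereal) \<Rightarrow> 'a set" where
  "inner_solutions \<phi> = {x. is_arg_min \<phi> (\<lambda>_. True) x}"

definition outer_solutions :: "('a \<Rightarrow> ereal) \<Rightarrow> ('a \<Rightarrow> ereal) \<Rightarrow> 'a set" where
  "outer_solutions \<phi> \<omega> = {x. is_arg_min \<omega> (\<lambda>z. z \<in> inner_solutions \<phi>) x \<and> \<bar>\<omega> x\<bar> \<noteq> \<infinity>}"

text \<open>Iterates and parameters are indexed by \<^typ>\<open>int\<close>, because the scheme refers to index \<open>-1\<close>;
  values at indices below \<open>-1\<close> play no role.\<close>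

definition alpha_seq :: "real \<Rightarrow> int \<Rightarrow> int \<Rightarrow> real" where
  "alpha_seq \<gamma> a k = (if k < 0 then 0 else (real_of_int (k + a)) powr (- \<gamma>))"

definition t_seq :: "int \<Rightarrow> int \<Rightarrow> real" where
  "t_seq a k = (if k < 0 then 0 else real_of_int (k + a) / real_of_int a)"

definition y_seq :: "int \<Rightarrow> (int \<Rightarrow> 'a::real_vector) \<Rightarrow> int \<Rightarrow> 'a" where
  "y_seq a x k = x k + (inverse (t_seq a k) * (t_seq a (k - 1) - 1)) *\<^sub>R (x k - x (k - 1))"

definition fbipg_sequence ::
  "('a::euclidean_space \<Rightarrow> real) \<Rightarrow> ('a \<Rightarrow> ereal) \<Rightarrow> ('a \<Rightarrow> real) \<Rightarrow> ('a \<Rightarrow> ereal) \<Rightarrow>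
    real \<Rightarrow> real \<Rightarrow> int \<Rightarrow> (int \<Rightarrow> 'a) \<Rightarrow> bool" where
  "fbipg_sequence f g \<sigma> \<psi> \<beta> \<gamma> a x \<longleftrightarrow>
     x (-1) = x 0 \<and>
     (\<forall>k\<ge>0.
        let fk = (\<lambda>z. f z + alpha_seq \<gamma> a k * \<sigma> z);
            gk = (\<lambda>z. g z + ereal (alpha_seq \<gamma> a k) * \<psi> z);
            yk = y_seq a x k
        in is_arg_min (\<lambda>z. gk z + ereal (z \<bullet> grad fk yk + \<beta> / 2 * (norm (z - yk))\<^sup>2))
             (\<lambda>_. True) (x (k + 1)))"

definition avg_iterate :: "(int \<Rightarrow> 'a::real_vector) \<Rightarrow> int \<Rightarrow> 'a" where
  "avg_iterate x k = (1 / real_of_int k) *\<^sub>R (\<Sum>s = 1..k. x s)"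

end

theory Submission
  imports Defs
begin

text \<open>The step with index \<open>k\<close> is an accelerated proximal gradient step for the penalized objective
  \<open>\<phi> + \<alpha>\<^sub>k \<omega>\<close>, whose smooth part has a gradient with Lipschitz constant at most \<open>\<beta>\<close> because
  \<open>\<alpha>\<^sub>k \<le> 1\<close>. Fix a solution \<open>x'\<close> and denote by \<open>P\<close> and \<open>W\<close> the gaps \<open>\<phi> - \<phi> x'\<close> and
  \<open>\<omega> - \<omega> x'\<close> along the iterates. The usual analysis of one accelerated step
  (\<open>accelerated_step_inequality\<close>) compares \<open>t\<^sub>k\<^sup>2\<close> times the new penalized gap with
  \<open>t\<^sub>k (t\<^sub>k - 1)\<close> times the old one, up to a telescoping squared distance. With
  \<open>t\<^sub>k = (k + a) / a\<close> and \<open>\<alpha>\<^sub>k = 1 / (k + a)\<close>, multiplication by \<open>a\<^sup>2\<close> turns this into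
  (\<open>scaled_step\<close>)

  \<open>(k + a)\<^sup>2 P (k + 1) + (k + a) W (k + 1) + U (k + 1) \<le> k (k + a) P k + k W k + U k\<close>.

  Summation (\<open>energy_bound\<close>) yields
  \<open>n (n + a) P n + n W n + (a - 1) (W 1 + \<dots> + W n) \<le> U 0\<close>, where
  \<open>U 0 = a\<^sup>2 \<beta> / 2 * (norm (x 0 - x'))\<^sup>2\<close>. The gap \<open>P\<close> is nonnegative, but \<open>W\<close> may have either
  sign; this is why the outer rate concerns the better of the last iterate and the average. Its
  outer gap \<open>w\<close> is at most \<open>W n\<close> and, by convexity, at most the mean of \<open>W 1, \<dots>, W n\<close>, so the
  energy bound gives \<open>a n w \<le> U 0\<close>, and \<open>n + 1 \<le> a n\<close> gives the outer rate.

  For the inner rate, \<open>W\<close> is bounded from below by \<open>- D\<close>, where \<open>D = \<omega> x' - \<omega>\<^sup>*\<close>. The energy bound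
  then gives \<open>P n \<le> U 0 / n\<^sup>2 + a D / (n + 1)\<close>. Averaging these bounds over the iterates produces
  \<open>\<Sum>1 / s\<^sup>2 \<le> \<pi>\<^sup>2 / 6\<close> and \<open>\<Sum>1 / (s + 1) \<le> ln (n + 1)\<close>, and convexity of \<open>\<phi>\<close> transfers the
  result to the average of the iterates; the last iterate satisfies the same bound.\<close>

section \<open>Convex functions with Lipschitz gradient\<close>

lemma has_real_derivative_along_line:
  fixes f :: "'a::euclidean_space \<Rightarrow> real"
  assumes "\<And>x. f differentiable (at x)"
  shows "((\<lambda>t. f (y + t *\<^sub>R d)) has_real_derivative d \<bullet> grad f (y + t *\<^sub>R d)) (at t)"
proof -
  have f': "(f has_derivative (\<lambda>h. h \<bullet> grad f (y + t *\<^sub>R d))) (at (y + t *\<^sub>R d))"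
    using GDERIV_grad[OF assms] unfolding gderiv_def .
  have line: "((\<lambda>t. y + t *\<^sub>R d) has_derivative (\<lambda>s. s *\<^sub>R d)) (at t)"
    by (auto intro!: derivative_eq_intros)
  show ?thesis
    using has_derivative_compose[OF line f']
    by (simp add: has_field_derivative_def mult_commute_abs)
qed

text \<open>Restricted to the line through \<open>y\<close> and \<open>z\<close>, a convex function is a convex function of one
  real variable, which lies above its tangents.\<close>

lemma gradient_inequality:
  fixes f :: "'a::euclidean_space \<Rightarrow> real"
  assumes "convex_on UNIV f" and "\<And>x. f differentiable (at x)"
  shows "f y + (z - y) \<bullet> grad f y \<le> f z"
proof -
  let ?h = "\<lambda>t. f (y + t *\<^sub>R (z - y))"
  have "convex_on UNIV ?h"
  proof (rule convex_onI)
    fix t u v :: real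
    assume t: "0 < t" "t < 1"
    have "y + ((1 - t) *\<^sub>R u + t *\<^sub>R v) *\<^sub>R (z - y)
        = (1 - t) *\<^sub>R (y + u *\<^sub>R (z - y)) + t *\<^sub>R (y + v *\<^sub>R (z - y))"
      by (simp add: algebra_simps)
    then show "?h ((1 - t) *\<^sub>R u + t *\<^sub>R v) \<le> (1 - t) * ?h u + t * ?h v"
      using convex_onD[OF assms(1), of t] t by simp
  qed simp
  moreover have "(?h has_real_derivative (z - y) \<bullet> grad f y) (at 0 within UNIV)"
    using has_real_derivative_along_line[OF assms(2), where y = y and d = "z - y" and t = 0] by simp
  ultimately have "?h 1 - ?h 0 \<ge> (z - y) \<bullet> grad f y * (1 - 0)"
    by (intro convex_on_imp_above_tangent[where A = UNIV]) auto
  then show ?thesis by simp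
qed

text \<open>Along the segment from \<open>y\<close> to \<open>z\<close>, the difference of the two sides is monotone in the
  parameter: by the Cauchy--Schwarz inequality and the Lipschitz bound on the gradient, its
  derivative has constant sign. Comparing the end points avoids any integration.\<close>

lemma descent_lemma:
  fixes f :: "'a::euclidean_space \<Rightarrow> real"
  assumes "smooth_with L f"
  shows "f z \<le> f y + (z - y) \<bullet> grad f y + L / 2 * (norm (z - y))\<^sup>2"
proof -
  define d where "d = z - y"
  have diff: "\<And>x. f differentiable (at x)" and lip: "L-lipschitz_on UNIV (grad f)"
    using assms unfolding smooth_with_def by auto
  let ?h = "\<lambda>t. f (y + t *\<^sub>R d) - t * (d \<bullet> grad f y) - L / 2 * t\<^sup>2 * (norm d)\<^sup>2"
  let ?h' = "\<lambda>t. d \<bullet> grad f (y + t *\<^sub>R d) - d \<bullet> grad f y - L * t * (norm d)\<^sup>2"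
  have deriv: "(?h has_real_derivative ?h' t) (at t)" for t
    by (rule derivative_eq_intros has_real_derivative_along_line diff refl | simp)+
  have nonpos: "?h' t \<le> 0" if "0 \<le> t" for t
  proof -
    have "d \<bullet> (grad f (y + t *\<^sub>R d) - grad f y) \<le> norm d * norm (grad f (y + t *\<^sub>R d) - grad f y)"
      by (rule norm_cauchy_schwarz)
    also have "\<dots> \<le> norm d * (L * norm (y + t *\<^sub>R d - y))"
      by (intro mult_left_mono lipschitz_on_normD[OF lip]) auto
    also have "\<dots> = L * t * (norm d)\<^sup>2"
      using that by (simp add: power2_eq_square)
    finally show ?thesis by (simp add: inner_diff_right)
  qed
  have "?h 1 \<le> ?h 0"
    by (rule DERIV_nonpos_imp_nonincreasing[where f = ?h]) (use deriv nonpos in \<open>auto intro!: exI\<close>)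
  then show ?thesis by (simp add: d_def)
qed

lemma smooth_with_add_scaled:
  fixes f \<sigma> :: "'a::euclidean_space \<Rightarrow> real"
  assumes f: "smooth_with Lf f" and \<sigma>: "smooth_with Ls \<sigma>" and c: "0 \<le> c"
  shows "smooth_with (Lf + c * Ls) (\<lambda>z. f z + c * \<sigma> z)"
proof -
  have diff: "f differentiable (at x)" "\<sigma> differentiable (at x)" for x
    using assms unfolding smooth_with_def by auto
  have "GDERIV (\<lambda>z. f z + c * \<sigma> z) x :> grad f x + c *\<^sub>R grad \<sigma> x" for x
    using GDERIV_grad[OF diff(1)[of x]] GDERIV_grad[OF diff(2)[of x]] unfolding gderiv_def
    by (auto intro!: derivative_eq_intros simp: inner_simps)
  then have grad: "grad (\<lambda>z. f z + c * \<sigma> z) = (\<lambda>x. grad f x + c *\<^sub>R grad \<sigma> x)"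
    by (auto intro: grad_eqI)
  have "(Lf + c * Ls)-lipschitz_on UNIV (\<lambda>x. grad f x + c *\<^sub>R grad \<sigma> x)"
    using f \<sigma> c unfolding smooth_with_def
    by (intro lipschitz_on_add lipschitz_on_cmult_nonneg) auto
  then show ?thesis
    unfolding smooth_with_def grad using diff
    by (auto intro: lipschitz_on_continuous_on)
qed

section \<open>The accelerated proximal gradient step\<close>

lemma norm_convex_combination_square:
  fixes v w :: "'a::real_inner"
  shows "(norm ((1 - u) *\<^sub>R v + u *\<^sub>R w))\<^sup>2
    = (1 - u) * (norm v)\<^sup>2 + u * (norm w)\<^sup>2 - u * (1 - u) * (norm (w - v))\<^sup>2"
  unfolding power2_norm_eq_inner
  by (simp add: inner_simps inner_commute) (simp add: algebra_simps power2_eq_square)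

text \<open>The objective grows quadratically away from its minimizer \<open>p\<close>. Comparing \<open>p\<close> with the points
  of the segment from \<open>p\<close> to \<open>z\<close> gives the claim up to a factor \<open>1 - u\<close> in front of the last
  square on the left; the factor disappears as the point approaches \<open>p\<close>.\<close>

lemma proximal_three_point_inequality:
  fixes h :: "'a::real_inner \<Rightarrow> real"
  assumes h: "convex_on S h" and p: "p \<in> S" and z: "z \<in> S"
    and min: "\<And>w. w \<in> S \<Longrightarrow> h p + b * (norm (p - y))\<^sup>2 \<le> h w + b * (norm (w - y))\<^sup>2"
  shows "h p + b * (norm (p - y))\<^sup>2 + b * (norm (z - p))\<^sup>2 \<le> h z + b * (norm (z - y))\<^sup>2"
proof -
  let ?A = "h p + b * (norm (p - y))\<^sup>2" and ?B = "h z + b * (norm (z - y))\<^sup>2"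
    and ?D = "b * (norm (z - p))\<^sup>2"
  have chord: "?A \<le> ?B - (1 - u) * ?D" if u: "0 < u" "u < 1" for u
  proof -
    let ?w = "(1 - u) *\<^sub>R p + u *\<^sub>R z"
    have "?w \<in> S"
      using convexD_alt[OF convex_on_imp_convex[OF h] p z] u by simp
    then have "?A \<le> h ?w + b * (norm (?w - y))\<^sup>2" by (rule min)
    also have "h ?w \<le> (1 - u) * h p + u * h z"
      using convex_onD[OF h _ _ p z] u by simp
    also have "(norm (?w - y))\<^sup>2
        = (1 - u) * (norm (p - y))\<^sup>2 + u * (norm (z - y))\<^sup>2 - u * (1 - u) * (norm (z - p))\<^sup>2"
      using norm_convex_combination_square[of u "p - y" "z - y"] by (simp add: algebra_simps)
    finally have "u * ?A \<le> u * (?B - (1 - u) * ?D)"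
      by (simp add: algebra_simps)
    then show ?thesis using u by simp
  qed
  have "((\<lambda>u. ?B - (1 - u) * ?D) \<longlongrightarrow> ?B - (1 - 0) * ?D) (at_right 0)"
    by (intro tendsto_intros)
  moreover have "\<forall>\<^sub>F u in at_right (0::real). ?A \<le> ?B - (1 - u) * ?D"
    unfolding eventually_at_right_field using chord by (intro exI[of _ 1]) auto
  ultimately have "?A \<le> ?B - (1 - 0) * ?D"
    by (intro tendsto_lowerbound) auto
  then show ?thesis by simp
qed

text \<open>The fundamental inequality of proximal gradient methods: at \<open>p\<close> the smooth part \<open>q\<close> is at most
  its quadratic upper model, at \<open>z\<close> it is at least its linearization, and between the two models
  the three-point inequality applies.\<close>

lemma proximal_gradient_inequality:
  fixes q h :: "'a::euclidean_space \<Rightarrow> real"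
  assumes q: "convex_on UNIV q" "smooth_with L q" and L: "L \<le> \<beta>"
    and h: "convex_on S h" and p: "p \<in> S" and z: "z \<in> S"
    and min: "\<And>w. w \<in> S \<Longrightarrow> h p + (p \<bullet> grad q y + \<beta> / 2 * (norm (p - y))\<^sup>2)
      \<le> h w + (w \<bullet> grad q y + \<beta> / 2 * (norm (w - y))\<^sup>2)"
  shows "q p + h p + \<beta> / 2 * (norm (z - p))\<^sup>2 \<le> q z + h z + \<beta> / 2 * (norm (z - y))\<^sup>2"
proof -
  have lin: "convex_on S (\<lambda>w. w \<bullet> grad q y)"
    by (intro convex_onI convex_on_imp_convex[OF h]) (simp add: inner_simps)
  have diff: "\<And>x. q differentiable (at x)"
    using q unfolding smooth_with_def by auto
  have "h p + p \<bullet> grad q y + \<beta> / 2 * (norm (p - y))\<^sup>2 + \<beta> / 2 * (norm (z - p))\<^sup>2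
      \<le> h z + z \<bullet> grad q y + \<beta> / 2 * (norm (z - y))\<^sup>2"
    using min by (intro proximal_three_point_inequality[OF convex_on_add[OF h lin] p z]) (simp add: add.assoc)
  moreover have "q p \<le> q y + (p - y) \<bullet> grad q y + L / 2 * (norm (p - y))\<^sup>2"
    by (rule descent_lemma[OF q(2)])
  moreover have "L / 2 * (norm (p - y))\<^sup>2 \<le> \<beta> / 2 * (norm (p - y))\<^sup>2"
    using L by (intro mult_right_mono) auto
  moreover have "q y + (z - y) \<bullet> grad q y \<le> q z"
    by (rule gradient_inequality[OF q(1) diff])
  ultimately show ?thesis
    by (simp add: inner_diff_left)
qed

text \<open>The proximal gradient inequality is applied at the point \<open>c = (1 - 1 / t) v + (1 / t) z\<close> between
  the current iterate \<open>v\<close> and the reference point \<open>z\<close>. Multiplied by \<open>t\<^sup>2\<close>, the two squared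
  distances from \<open>c\<close> become squares that telescope for the extrapolation rule of the scheme.
  For \<open>t = 1\<close> the iterate \<open>v\<close> has weight zero and may lie outside \<open>S\<close>: this
  covers the first step, since the objectives may be infinite at the starting point.\<close>

lemma accelerated_step_inequality:
  fixes q h :: "'a::euclidean_space \<Rightarrow> real" and t \<beta> :: real
  assumes q: "convex_on UNIV q" "smooth_with L q" and L: "L \<le> \<beta>"
    and h: "convex_on S h" and p: "p \<in> S" and z: "z \<in> S"
    and min: "\<And>w. w \<in> S \<Longrightarrow> h p + (p \<bullet> grad q y + \<beta> / 2 * (norm (p - y))\<^sup>2)
      \<le> h w + (w \<bullet> grad q y + \<beta> / 2 * (norm (w - y))\<^sup>2)"
    and t: "1 \<le> t" and v: "t = 1 \<or> v \<in> S"
  shows "t\<^sup>2 * (q p + h p - (q z + h z)) + \<beta> / 2 * (norm (t *\<^sub>R p - (t - 1) *\<^sub>R v - z))\<^sup>2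
    \<le> t * (t - 1) * (q v + h v - (q z + h z)) + \<beta> / 2 * (norm (t *\<^sub>R y - (t - 1) *\<^sub>R v - z))\<^sup>2"
proof -
  let ?F = "\<lambda>w. q w + h w"
  define c where "c = (1 - 1 / t) *\<^sub>R v + (1 / t) *\<^sub>R z"
  have cS: "c \<in> S" and Fc: "?F c \<le> (1 - 1 / t) * ?F v + 1 / t * ?F z"
  proof -
    have "convex_on S ?F"
      by (intro convex_on_add convex_on_subset[OF q(1)] h convex_on_imp_convex[OF h]) auto
    then show "c \<in> S" "?F c \<le> (1 - 1 / t) * ?F v + 1 / t * ?F z"
      using v t z convexD_alt[OF convex_on_imp_convex[OF h], of v z "1 / t"] convex_onD[of S ?F "1 / t" v z]
      by (cases "t = 1"; auto simp: c_def)+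
  qed
  have tc: "t *\<^sub>R c = (t - 1) *\<^sub>R v + z"
    using t by (simp add: c_def scaleR_right_distrib algebra_simps)
  have "(norm (t *\<^sub>R w - (t - 1) *\<^sub>R v - z))\<^sup>2 = t\<^sup>2 * (norm (c - w))\<^sup>2" for w
  proof -
    have "t *\<^sub>R w - (t - 1) *\<^sub>R v - z = - (t *\<^sub>R (c - w))"
      using tc by (simp add: scaleR_right_diff_distrib)
    then show ?thesis by (simp add: power_mult_distrib)
  qed
  note scaled = this
  have "?F p + \<beta> / 2 * (norm (c - p))\<^sup>2 \<le> ?F c + \<beta> / 2 * (norm (c - y))\<^sup>2"
    by (rule proximal_gradient_inequality[OF q L h p cS min])
  with Fc have "?F p + \<beta> / 2 * (norm (c - p))\<^sup>2
      \<le> (1 - 1 / t) * ?F v + 1 / t * ?F z + \<beta> / 2 * (norm (c - y))\<^sup>2" by linarith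
  then have "t\<^sup>2 * (?F p + \<beta> / 2 * (norm (c - p))\<^sup>2)
      \<le> t\<^sup>2 * ((1 - 1 / t) * ?F v + 1 / t * ?F z + \<beta> / 2 * (norm (c - y))\<^sup>2)"
    by (rule mult_left_mono) simp
  also have "\<dots> = t * (t - 1) * ?F v + t * ?F z + \<beta> / 2 * (t\<^sup>2 * (norm (c - y))\<^sup>2)"
    using t by (simp add: field_simps power2_eq_square)
  finally show ?thesis
    unfolding scaled by (simp add: algebra_simps power2_eq_square)
qed

section \<open>Rates from a recursive inequality\<close>

lemma sum_inverse_squares_le: "(\<Sum>s = 1..n. 1 / (real s)\<^sup>2) \<le> pi\<^sup>2 / 6"
proof -
  have "(\<Sum>s = 1..n. 1 / (real s)\<^sup>2) = (\<Sum>i<n. 1 / (real i + 1)\<^sup>2)"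
    by (rule sum.reindex_bij_witness[of _ Suc "\<lambda>s. s - 1"]) (auto simp: of_nat_diff)
  also have "\<dots> \<le> pi\<^sup>2 / 6"
    using sum_le_suminf[OF sums_summable[OF inverse_squares_sums], of "{..<n}"]
      sums_unique[OF inverse_squares_sums] by (simp add: add.commute)
  finally show ?thesis .
qed

text \<open>One term of the comparison of the harmonic sum with the logarithm, which then telescopes.\<close>

lemma inverse_Suc_le_ln_diff:
  assumes "0 < s"
  shows "1 / (real s + 1) \<le> ln (real s + 1) - ln (real s)"
  using ln_le_minus_one[of "real s / (real s + 1)"] assms
  by (simp add: ln_div field_simps)

lemma sum_inverse_Suc_le_ln: "(\<Sum>s = 1..n. 1 / (real s + 1)) \<le> ln (real n + 1)"
proof (induction n)
  case (Suc n)
  show ?case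
    using Suc inverse_Suc_le_ln_diff[of "Suc n"] by (simp add: add.commute)
qed simp

text \<open>The recursion satisfied by the gaps along the iterates, multiplied by \<open>a\<^sup>2\<close>: \<open>P\<close> is the gap of
  the inner objective, \<open>W\<close> that of the outer one, and \<open>U\<close> the squared-distance potential. The sign
  of \<open>W\<close> is unknown, because an iterate outside the inner solution set can have a smaller outer
  value than the solution.\<close>

context
  fixes a :: real and P W U :: "nat \<Rightarrow> real"
  assumes a: "2 \<le> a"
    and P_nonneg: "\<And>n. 0 < n \<Longrightarrow> 0 \<le> P n"
    and U_nonneg: "\<And>n. 0 \<le> U n"
    and step: "\<And>k. (real k + a)\<^sup>2 * P (Suc k) + (real k + a) * W (Suc k) + U (Suc k)
      \<le> real k * (real k + a) * P k + real k * W k + U k"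
begin

text \<open>The outer terms do not telescope completely: \<open>n + a\<close> copies of \<open>W (Suc n)\<close> appear and only
  \<open>n + 1\<close> are cancelled by the next step, so \<open>a - 1\<close> copies of every value accumulate.
  These leftovers, which could not be discarded for lack of a sign, are what makes the average of
  the iterates useful. For \<open>P\<close> the leftovers are nonnegative, as
  \<open>(n + 1) (n + 1 + a) \<le> (n + a)\<^sup>2\<close> for \<open>a \<ge> 2\<close>.\<close>

lemma energy_bound:
  "real n * (real n + a) * P n + real n * W n + (a - 1) * (\<Sum>s = 1..n. W s) + U n \<le> U 0"
proof (induction n)
  case (Suc n)
  have "real (Suc n) * (real (Suc n) + a) \<le> (real n + a)\<^sup>2"
  proof -
    have "(real n + a)\<^sup>2 - real (Suc n) * (real (Suc n) + a) = (a - 2) * (real n + a + 1) + 1"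
      by (simp add: algebra_simps power2_eq_square)
    moreover have "0 \<le> (a - 2) * (real n + a + 1)" using a by simp
    ultimately show ?thesis by linarith
  qed
  then have "real (Suc n) * (real (Suc n) + a) * P (Suc n) \<le> (real n + a)\<^sup>2 * P (Suc n)"
    using P_nonneg[of "Suc n"] by (intro mult_right_mono) auto
  then show ?case
    using Suc step[of n] by (simp add: algebra_simps)
qed simp

text \<open>If \<open>w\<close> is below both the last value and the mean, then the \<open>n\<close> copies of the last value and the
  \<open>a - 1\<close> copies of the sum together contribute at least \<open>a n w\<close> to the energy.\<close>

lemma outer_rate:
  assumes n: "0 < n" and w: "w \<le> W n" "real n * w \<le> (\<Sum>s = 1..n. W s)"
  shows "w \<le> U 0 / (real n + 1)"
proof (cases "w \<le> 0")
  case True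
  have "0 \<le> U 0 / (real n + 1)"
    using U_nonneg by simp
  with True show ?thesis by linarith
next
  case False
  have "0 \<le> real n * (real n + a) * P n"
    using a P_nonneg[OF n] by simp
  moreover have "real n * w \<le> real n * W n"
    using w(1) by (intro mult_left_mono) auto
  moreover have "(a - 1) * (real n * w) \<le> (a - 1) * (\<Sum>s = 1..n. W s)"
    using a w(2) by (intro mult_left_mono) auto
  ultimately have "a * real n * w \<le> U 0"
    using energy_bound[of n] U_nonneg[of n] by (simp add: algebra_simps)
  moreover have "(real n + 1) * w \<le> a * real n * w"
  proof -
    have "real n + 1 \<le> 2 * real n" using n by simp
    also have "\<dots> \<le> a * real n" using a by (intro mult_right_mono) auto
    finally show ?thesis using False by (intro mult_right_mono) auto
  qed
  ultimately show ?thesis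
    by (simp add: field_simps)
qed

text \<open>The outer terms contribute at least \<open>- a n D\<close> to the energy, which leaves a bound on
  \<open>n (n + a) P n\<close>.\<close>

lemma inner_gap_bound:
  assumes n: "0 < n" and W: "\<And>s. 0 < s \<Longrightarrow> - D \<le> W s" and D: "0 \<le> D"
  shows "P n \<le> U 0 * (1 / (real n)\<^sup>2) + a * D * (1 / (real n + 1))"
proof -
  have "real n * - D \<le> real n * W n"
    using W[OF n] by (intro mult_left_mono) auto
  moreover have "(a - 1) * (real n * - D) \<le> (a - 1) * (\<Sum>s = 1..n. W s)"
    using a W sum_bounded_below[of "{1..n}" "- D" W] by (intro mult_left_mono) auto
  ultimately have "real n * (real n + a) * P n \<le> U 0 + a * real n * D"
    using energy_bound[of n] U_nonneg[of n] by (simp add: algebra_simps)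
  then have "P n \<le> (U 0 + a * real n * D) / (real n * (real n + a))"
    using n a by (simp add: pos_le_divide_eq mult.commute[of "P n"])
  also have "\<dots> = U 0 * (1 / (real n * (real n + a))) + a * D * (1 / (real n + a))"
    using n a by (simp add: add_divide_distrib)
  also have "\<dots> \<le> U 0 * (1 / (real n)\<^sup>2) + a * D * (1 / (real n + 1))"
    using n a D U_nonneg[of 0]
    by (intro add_mono mult_left_mono divide_left_mono) (auto simp: power2_eq_square)
  finally show ?thesis .
qed

text \<open>The mean of the bounds on the single gaps produces the series \<open>\<Sum>1 / s\<^sup>2\<close>, hence the constant
  \<open>\<pi>\<^sup>2 / 6\<close>, and the harmonic sum, hence the logarithm. The last gap alone decays faster and
  satisfies the same bound, because \<open>\<pi>\<^sup>2 / 6 \<ge> 1\<close> and \<open>n / (n + 1) \<le> ln (n + 1)\<close>.\<close>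

lemma inner_rate:
  assumes n: "0 < n" and W: "\<And>s. 0 < s \<Longrightarrow> - D \<le> W s" and D: "0 \<le> D"
    and p: "p \<le> P n \<or> real n * p \<le> (\<Sum>s = 1..n. P s)"
  shows "real n * p \<le> pi\<^sup>2 / 6 * U 0 + a\<^sup>2 * ln (real n + 1) * D"
proof -
  have "real n * p \<le> U 0 * (pi\<^sup>2 / 6) + a * D * ln (real n + 1)"
    using p
  proof
    assume avg: "real n * p \<le> (\<Sum>s = 1..n. P s)"
    have "(\<Sum>s = 1..n. P s) \<le> (\<Sum>s = 1..n. U 0 * (1 / (real s)\<^sup>2) + a * D * (1 / (real s + 1)))"
      using inner_gap_bound[OF _ W D] by (intro sum_mono) auto
    also have "\<dots> = U 0 * (\<Sum>s = 1..n. 1 / (real s)\<^sup>2) + a * D * (\<Sum>s = 1..n. 1 / (real s + 1))"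
      by (simp add: sum.distrib sum_distrib_left)
    also have "\<dots> \<le> U 0 * (pi\<^sup>2 / 6) + a * D * ln (real n + 1)"
      using a D U_nonneg[of 0] sum_inverse_squares_le sum_inverse_Suc_le_ln
      by (intro add_mono mult_left_mono) auto
    finally show ?thesis using avg by simp
  next
    assume last: "p \<le> P n"
    have "real n * (1 / (real n)\<^sup>2) \<le> pi\<^sup>2 / 6"
    proof -
      have "real n * (1 / (real n)\<^sup>2) \<le> 1" using n by (simp add: power2_eq_square)
      also have "\<dots> \<le> pi\<^sup>2 / 6" using sum_inverse_squares_le[of 1] by simp
      finally show ?thesis .
    qed
    \<comment> \<open>This is \<open>ln y \<le> y - 1\<close> at \<open>y = 1 / (n + 1)\<close>.\<close>
    moreover have "real n * (1 / (real n + 1)) \<le> ln (real n + 1)"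
      using ln_le_minus_one[of "1 / (real n + 1)"] by (simp add: ln_div field_simps)
    ultimately have "U 0 * (real n * (1 / (real n)\<^sup>2)) + a * D * (real n * (1 / (real n + 1)))
        \<le> U 0 * (pi\<^sup>2 / 6) + a * D * ln (real n + 1)"
      using a D U_nonneg[of 0] by (intro add_mono mult_left_mono) auto
    moreover have "real n * p \<le> real n * (U 0 * (1 / (real n)\<^sup>2) + a * D * (1 / (real n + 1)))"
      using last inner_gap_bound[OF n W D] by (intro mult_left_mono) auto
    ultimately show ?thesis
      by (simp only: distrib_left mult.left_commute[of "real n"] mult.assoc)
  qed
  also have "\<dots> \<le> U 0 * (pi\<^sup>2 / 6) + a\<^sup>2 * D * ln (real n + 1)"
    using a D by (intro add_left_mono mult_right_mono) (auto simp: power2_eq_square)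
  finally show ?thesis by (simp add: mult_ac)
qed

end

section \<open>Extended-valued objectives and averages\<close>

lemma convex_on_effective_domain:
  assumes "proper_fun g" and "convex_fun g"
  shows "convex_on {z. g z \<noteq> \<infinity>} (\<lambda>z. real_of_ereal (g z))"
proof -
  have key: "g (u *\<^sub>R x + v *\<^sub>R y) \<noteq> \<infinity> \<and>
      real_of_ereal (g (u *\<^sub>R x + v *\<^sub>R y)) \<le> u * real_of_ereal (g x) + v * real_of_ereal (g y)"
    if finite: "g x \<noteq> \<infinity>" "g y \<noteq> \<infinity>" and weights: "0 \<le> u" "0 \<le> v" "u + v = 1" for x y u v
  proof -
    have fin: "g z \<noteq> - \<infinity>" for z using assms(1) by (simp add: proper_fun_def)
    obtain r s where "g x = ereal r" "g y = ereal s"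
      using finite fin[of x] fin[of y] by (cases "g x"; cases "g y") auto
    moreover have "g (u *\<^sub>R x + v *\<^sub>R y) \<le> ereal u * g x + ereal v * g y"
      using assms(2) weights by (simp add: convex_fun_def)
    ultimately show ?thesis
      using fin[of "u *\<^sub>R x + v *\<^sub>R y"] by (cases "g (u *\<^sub>R x + v *\<^sub>R y)") auto
  qed
  then show ?thesis
    by (simp add: convex_on_def convex_def)
qed

text \<open>Since \<open>c\<close> is positive, a minimizer whose value does not exceed a finite one has both
  extended-valued terms finite. The minimality can then be read as a statement on real numbers.\<close>

lemma minimizer_on_effective_domain:
  fixes g \<psi> :: "'a \<Rightarrow> ereal" and r :: "'a \<Rightarrow> real"
  assumes proper: "proper_fun g" "proper_fun \<psi>" and c: "0 < c"
    and min: "is_arg_min (\<lambda>z. g z + ereal c * \<psi> z + ereal (r z)) (\<lambda>_. True) p"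
    and z: "g z \<noteq> \<infinity>" "\<psi> z \<noteq> \<infinity>"
  shows "g p \<noteq> \<infinity>" and "\<psi> p \<noteq> \<infinity>"
    and "real_of_ereal (g p) + c * real_of_ereal (\<psi> p) + r p
      \<le> real_of_ereal (g z) + c * real_of_ereal (\<psi> z) + r z"
proof -
  have fin: "g w \<noteq> - \<infinity>" "\<psi> w \<noteq> - \<infinity>" for w
    using proper by (auto simp: proper_fun_def)
  have le: "g p + ereal c * \<psi> p + ereal (r p) \<le> g z + ereal c * \<psi> z + ereal (r z)"
    using min by (simp add: is_arg_min_linorder)
  obtain s t where st: "g z = ereal s" "\<psi> z = ereal t"
    using z fin[of z] by (cases "g z"; cases "\<psi> z") auto
  show g: "g p \<noteq> \<infinity>"
    using le c fin[of p] unfolding st by (cases "\<psi> p") auto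
  show \<psi>: "\<psi> p \<noteq> \<infinity>"
    using le c fin[of p] unfolding st by (cases "g p") auto
  obtain s' t' where "g p = ereal s'" "\<psi> p = ereal t'"
    using g \<psi> fin[of p] by (cases "g p"; cases "\<psi> p") auto
  with le st show "real_of_ereal (g p) + c * real_of_ereal (\<psi> p) + r p
      \<le> real_of_ereal (g z) + c * real_of_ereal (\<psi> z) + r z"
    by simp
qed

text \<open>Jensen's inequality for the ergodic average.\<close>

lemma convex_on_avg_iterate:
  assumes "convex_on S h" and "0 < n" and "\<And>s. 0 < s \<Longrightarrow> x (int s) \<in> S"
  shows "avg_iterate x (int n) \<in> S"
    and "real n * h (avg_iterate x (int n)) \<le> (\<Sum>s = 1..n. h (x (int s)))"
proof -
  have avg: "avg_iterate x (int n) = (\<Sum>s = 1..n. (1 / real n) *\<^sub>R x (int s))"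
  proof -
    have "(\<Sum>s = 1..int n. x s) = (\<Sum>s = 1..n. x (int s))"
      by (rule sum.reindex_bij_witness[of _ int nat]) auto
    then show ?thesis by (simp add: avg_iterate_def scaleR_sum_right)
  qed
  show "avg_iterate x (int n) \<in> S"
    unfolding avg using assms
    by (intro convex_sum convex_on_imp_convex[OF assms(1)]) auto
  have "h (avg_iterate x (int n)) \<le> (\<Sum>s = 1..n. 1 / real n * h (x (int s)))"
    unfolding avg using assms by (intro convex_on_sum[OF _ _ assms(1)]) auto
  then show "real n * h (avg_iterate x (int n)) \<le> (\<Sum>s = 1..n. h (x (int s)))"
    using \<open>0 < n\<close> by (simp add: sum_divide_distrib[symmetric] field_simps)
qed

section \<open>Convergence rates of the scheme\<close>

text \<open>A run of the scheme with \<open>\<gamma> = 1\<close>, compared with a minimizer \<open>x'\<close> of the inner objective at which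
  the outer one is finite.\<close>

locale fbipg_run =
  fixes f \<sigma> :: "'a::euclidean_space \<Rightarrow> real" and g \<psi> :: "'a \<Rightarrow> ereal"
    and \<beta>f \<beta>\<sigma> :: real and a :: int and x :: "int \<Rightarrow> 'a" and x' :: 'a
  assumes f: "convex_on UNIV f" "smooth_with \<beta>f f"
    and \<sigma>: "convex_on UNIV \<sigma>" "smooth_with \<beta>\<sigma> \<sigma>"
    and g: "proper_fun g" "convex_fun g"
    and \<psi>: "proper_fun \<psi>" "convex_fun \<psi>"
    and a: "2 \<le> a"
    and run: "fbipg_sequence f g \<sigma> \<psi> (\<beta>f + \<beta>\<sigma>) 1 a x"
    and x': "g x' \<noteq> \<infinity>" "\<psi> x' \<noteq> \<infinity>"
    and x'_min: "\<And>z. composite f g x' \<le> composite f g z"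
begin

definition eff_dom :: "'a set" where
  "eff_dom = {z. g z \<noteq> \<infinity> \<and> \<psi> z \<noteq> \<infinity>}"

definition inner_gap :: "'a \<Rightarrow> real" where
  "inner_gap z = f z + real_of_ereal (g z) - (f x' + real_of_ereal (g x'))"

definition outer_gap :: "'a \<Rightarrow> real" where
  "outer_gap z = \<sigma> z + real_of_ereal (\<psi> z) - (\<sigma> x' + real_of_ereal (\<psi> x'))"

text \<open>The vector whose squared norm is the potential that telescopes over the steps.\<close>

definition offset :: "int \<Rightarrow> 'a" where
  "offset k = t_seq a (k - 1) *\<^sub>R x k - (t_seq a (k - 1) - 1) *\<^sub>R x (k - 1) - x'"

lemma x'_in_eff_dom: "x' \<in> eff_dom"
  using x' by (simp add: eff_dom_def)

lemma composite_on_eff_dom: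
  assumes "z \<in> eff_dom"
  shows "composite f g z = ereal (f z + real_of_ereal (g z))"
    and "composite \<sigma> \<psi> z = ereal (\<sigma> z + real_of_ereal (\<psi> z))"
proof -
  have "g z \<noteq> - \<infinity>" "\<psi> z \<noteq> - \<infinity>" using g(1) \<psi>(1) by (auto simp: proper_fun_def)
  then obtain u v where "g z = ereal u" "\<psi> z = ereal v"
    using assms by (cases "g z"; cases "\<psi> z") (auto simp: eff_dom_def)
  then show "composite f g z = ereal (f z + real_of_ereal (g z))"
    "composite \<sigma> \<psi> z = ereal (\<sigma> z + real_of_ereal (\<psi> z))"
    by (simp_all add: composite_def)
qed

lemma convex_on_eff_dom:
  shows "convex_on eff_dom (\<lambda>z. real_of_ereal (g z))" and "convex_on eff_dom (\<lambda>z. real_of_ereal (\<psi> z))"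
proof -
  note cg = convex_on_effective_domain[OF g] and c\<psi> = convex_on_effective_domain[OF \<psi>]
  have "eff_dom = {z. g z \<noteq> \<infinity>} \<inter> {z. \<psi> z \<noteq> \<infinity>}" by (auto simp: eff_dom_def)
  then have eff_dom: "convex eff_dom" "eff_dom \<subseteq> {z. g z \<noteq> \<infinity>}" "eff_dom \<subseteq> {z. \<psi> z \<noteq> \<infinity>}"
    using convex_Int[OF convex_on_imp_convex[OF cg] convex_on_imp_convex[OF c\<psi>]] by simp_all
  show "convex_on eff_dom (\<lambda>z. real_of_ereal (g z))"
    by (rule convex_on_subset[OF cg eff_dom(2) eff_dom(1)])
  show "convex_on eff_dom (\<lambda>z. real_of_ereal (\<psi> z))"
    by (rule convex_on_subset[OF c\<psi> eff_dom(3) eff_dom(1)])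
qed

lemma gaps_convex: "convex_on eff_dom inner_gap" "convex_on eff_dom outer_gap"
proof -
  have eff_dom: "convex eff_dom" by (rule convex_on_imp_convex[OF convex_on_eff_dom(1)])
  note f_dom = convex_on_subset[OF f(1) subset_UNIV eff_dom]
    and \<sigma>_dom = convex_on_subset[OF \<sigma>(1) subset_UNIV eff_dom]
  show "convex_on eff_dom inner_gap"
    unfolding inner_gap_def[abs_def]
    by (rule convex_on_diff[OF convex_on_add[OF f_dom convex_on_eff_dom(1)]])
      (simp add: concave_on_const eff_dom)
  show "convex_on eff_dom outer_gap"
    unfolding outer_gap_def[abs_def]
    by (rule convex_on_diff[OF convex_on_add[OF \<sigma>_dom convex_on_eff_dom(2)]])
      (simp add: concave_on_const eff_dom)
qed

lemma inner_gap_nonneg: "z \<in> eff_dom \<Longrightarrow> 0 \<le> inner_gap z"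
  using x'_min[of z] composite_on_eff_dom(1) x'_in_eff_dom by (simp add: inner_gap_def)

text \<open>Every iterate after the starting point has finite objective values, because its subproblem
  has a finite value at \<open>x'\<close>; on the effective domain the subproblem is real-valued.\<close>

lemma iterate_minimizes:
  assumes k: "0 \<le> k"
  defines "c \<equiv> 1 / real_of_int (k + a)" and "y \<equiv> y_seq a x k"
  shows "x (k + 1) \<in> eff_dom"
    and "w \<in> eff_dom \<Longrightarrow>
      real_of_ereal (g (x (k + 1))) + c * real_of_ereal (\<psi> (x (k + 1)))
        + (x (k + 1) \<bullet> grad (\<lambda>z. f z + c * \<sigma> z) y + (\<beta>f + \<beta>\<sigma>) / 2 * (norm (x (k + 1) - y))\<^sup>2)
      \<le> real_of_ereal (g w) + c * real_of_ereal (\<psi> w)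
        + (w \<bullet> grad (\<lambda>z. f z + c * \<sigma> z) y + (\<beta>f + \<beta>\<sigma>) / 2 * (norm (w - y))\<^sup>2)"
proof -
  have "alpha_seq 1 a k = c"
    using k a by (simp add: alpha_seq_def c_def powr_minus_divide)
  then have min: "is_arg_min (\<lambda>z. g z + ereal c * \<psi> z
      + ereal (z \<bullet> grad (\<lambda>z. f z + c * \<sigma> z) y + (\<beta>f + \<beta>\<sigma>) / 2 * (norm (z - y))\<^sup>2))
      (\<lambda>_. True) (x (k + 1))"
    using run k unfolding fbipg_sequence_def Let_def y_def by auto
  have c: "0 < c" using k a by (simp add: c_def)
  note res = minimizer_on_effective_domain[OF g(1) \<psi>(1) c min]
  show "x (k + 1) \<in> eff_dom" using res(1,2)[OF x'] by (simp add: eff_dom_def)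
  show "real_of_ereal (g (x (k + 1))) + c * real_of_ereal (\<psi> (x (k + 1)))
        + (x (k + 1) \<bullet> grad (\<lambda>z. f z + c * \<sigma> z) y + (\<beta>f + \<beta>\<sigma>) / 2 * (norm (x (k + 1) - y))\<^sup>2)
      \<le> real_of_ereal (g w) + c * real_of_ereal (\<psi> w)
        + (w \<bullet> grad (\<lambda>z. f z + c * \<sigma> z) y + (\<beta>f + \<beta>\<sigma>) / 2 * (norm (w - y))\<^sup>2)" if "w \<in> eff_dom"
    using res(3) that by (simp add: eff_dom_def)
qed

lemma iterate_in_eff_dom: "0 < k \<Longrightarrow> x k \<in> eff_dom"
  using iterate_minimizes(1)[of "k - 1"] by simp

lemma offset_0: "offset 0 = x 0 - x'"
  using run by (simp add: offset_def t_seq_def fbipg_sequence_def)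

text \<open>The extrapolated point \<open>y\<^sup>k\<close> is defined so that this holds: the potential before step \<open>k\<close> is the
  squared distance left over by step \<open>k - 1\<close>.\<close>

lemma offset_y_seq:
  assumes "0 \<le> k"
  shows "t_seq a k *\<^sub>R y_seq a x k - (t_seq a k - 1) *\<^sub>R x k - x' = offset k"
proof -
  have "t_seq a k \<noteq> 0" using assms a by (simp add: t_seq_def)
  then have "t_seq a k *\<^sub>R (inverse (t_seq a k) * r) *\<^sub>R v = r *\<^sub>R v" for r and v :: 'a
    by simp
  then show ?thesis
    by (simp add: y_seq_def offset_def scaleR_right_distrib del: scaleR_scaleR) (simp add: algebra_simps)
qed

text \<open>For \<open>\<gamma> = 1\<close> the penalty weight \<open>1 / (k + a)\<close> cancels one factor of \<open>t\<^sub>k\<close> up to a constant, so that the outer gaps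
  carry the linear weights \<open>k + a\<close> and \<open>k\<close>, while the inner gaps carry quadratic ones. For \<open>k = 0\<close>
  the weights of the possibly meaningless gaps at the starting point vanish.\<close>

lemma scaled_step:
  fixes k :: nat
  shows "(real k + a)\<^sup>2 * inner_gap (x (int (Suc k))) + (real k + a) * outer_gap (x (int (Suc k)))
      + (real_of_int a)\<^sup>2 * (\<beta>f + \<beta>\<sigma>) / 2 * (norm (offset (int (Suc k))))\<^sup>2
    \<le> real k * (real k + a) * inner_gap (x (int k)) + real k * outer_gap (x (int k))
      + (real_of_int a)\<^sup>2 * (\<beta>f + \<beta>\<sigma>) / 2 * (norm (offset (int k)))\<^sup>2"
proof -
  \<comment> \<open>\<open>c\<close> is the penalty weight \<open>\<alpha>\<^sub>k\<close>; with \<open>c \<le> 1\<close> the gradient of the smooth part has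
    Lipschitz constant at most \<open>\<beta>f + \<beta>\<sigma>\<close> in every step.\<close>
  define t c where "t = (real k + a) / a" and "c = 1 / (real k + a)"
  define p y where "p = x (int k + 1)" and "y = y_seq a x (int k)"
  have a_pos: "0 < real_of_int a" using a by simp
  have t: "t_seq a (int k) = t" by (simp add: t_seq_def t_def)
  have t1: "1 \<le> t" using a_pos by (simp add: t_def field_simps)
  have c: "0 < c" "c \<le> 1" using a by (auto simp: c_def field_simps)
  have eff_dom: "t = 1 \<or> x (int k) \<in> eff_dom"
    using iterate_in_eff_dom[of "int k"] a_pos by (cases "k = 0") (auto simp: t_def)
  have \<beta>\<sigma>: "0 \<le> \<beta>\<sigma>" using \<sigma>(2) lipschitz_on_nonneg unfolding smooth_with_def by blast
  let ?q = "\<lambda>z. f z + c * \<sigma> z" and ?h = "\<lambda>z. real_of_ereal (g z) + c * real_of_ereal (\<psi> z)"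
  have convex: "convex_on UNIV ?q" "convex_on eff_dom ?h"
    using f(1) \<sigma>(1) c convex_on_eff_dom by (simp_all add: convex_on_add convex_on_cmul)
  have "\<beta>f + c * \<beta>\<sigma> \<le> \<beta>f + \<beta>\<sigma>" using c \<beta>\<sigma> by (simp add: mult_left_le_one_le)
  note step = accelerated_step_inequality[OF convex(1) smooth_with_add_scaled[OF f(2) \<sigma>(2)]
      this convex(2) _ x'_in_eff_dom _ t1 eff_dom, where p = p and y = y]
  have "t\<^sup>2 * (inner_gap p + c * outer_gap p) + (\<beta>f + \<beta>\<sigma>) / 2 * (norm (offset (int k + 1)))\<^sup>2
      \<le> t * (t - 1) * (inner_gap (x (int k)) + c * outer_gap (x (int k)))
        + (\<beta>f + \<beta>\<sigma>) / 2 * (norm (offset (int k)))\<^sup>2"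
  proof -
    have gap: "?q z + ?h z - (?q x' + ?h x') = inner_gap z + c * outer_gap z" for z
      by (simp add: inner_gap_def outer_gap_def algebra_simps)
    have off: "offset (int k + 1) = t *\<^sub>R p - (t - 1) *\<^sub>R x (int k) - x'"
      "offset (int k) = t *\<^sub>R y - (t - 1) *\<^sub>R x (int k) - x'"
      using offset_y_seq[of "int k"] by (simp_all add: offset_def p_def y_def t)
    show ?thesis
      unfolding off gap[symmetric]
      using iterate_minimizes[of "int k"] c by (intro step) (auto simp: p_def y_def c_def)
  qed
  then have "(real_of_int a)\<^sup>2 * (t\<^sup>2 * (inner_gap p + c * outer_gap p) + (\<beta>f + \<beta>\<sigma>) / 2 * (norm (offset (int k + 1)))\<^sup>2)
      \<le> (real_of_int a)\<^sup>2 * (t * (t - 1) * (inner_gap (x (int k)) + c * outer_gap (x (int k)))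
        + (\<beta>f + \<beta>\<sigma>) / 2 * (norm (offset (int k)))\<^sup>2)"
    by (rule mult_left_mono) simp
  moreover have "(real_of_int a)\<^sup>2 * (t\<^sup>2 * (u + c * v) + b) = (real k + a)\<^sup>2 * u + (real k + a) * v + (real_of_int a)\<^sup>2 * b"
    and "(real_of_int a)\<^sup>2 * (t * (t - 1) * (u + c * v) + b) = real k * (real k + a) * u + real k * v + (real_of_int a)\<^sup>2 * b" for u v b :: real
  proof -
    have at: "a * t = real k + a" "(real k + a) * c = 1"
      using a_pos by (simp_all add: t_def c_def add_nonneg_pos[THEN less_imp_neq, THEN not_sym])
    have "(real_of_int a)\<^sup>2 * (t\<^sup>2 * (u + c * v) + b) = (a * t)\<^sup>2 * u + (a * t) * ((a * t) * c) * v + (real_of_int a)\<^sup>2 * b"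
      by (simp add: algebra_simps power2_eq_square)
    then show "(real_of_int a)\<^sup>2 * (t\<^sup>2 * (u + c * v) + b) = (real k + a)\<^sup>2 * u + (real k + a) * v + (real_of_int a)\<^sup>2 * b"
      by (simp only: at mult_1_right)
    have "(real_of_int a)\<^sup>2 * (t * (t - 1) * (u + c * v) + b)
        = (a * t - a) * (a * t) * u + (a * t - a) * ((a * t) * c) * v + (real_of_int a)\<^sup>2 * b"
      by (simp add: algebra_simps power2_eq_square)
    then show "(real_of_int a)\<^sup>2 * (t * (t - 1) * (u + c * v) + b) = real k * (real k + a) * u + real k * v + (real_of_int a)\<^sup>2 * b"
      by (simp only: at mult_1_right add_diff_cancel_right')
  qed
  ultimately show ?thesis by (simp add: p_def add.commute)
qed

lemma smoothness_sum_nonneg: "0 \<le> \<beta>f + \<beta>\<sigma>"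
  using f(2) \<sigma>(2) lipschitz_on_nonneg unfolding smooth_with_def by (metis add_nonneg_nonneg)

lemma candidate_in_eff_dom:
  assumes "0 < n" and "z \<in> {x (int n), avg_iterate x (int n)}"
  shows "z \<in> eff_dom"
  using assms iterate_in_eff_dom convex_on_avg_iterate(1)[OF gaps_convex(1), of n x] by auto

lemma outer_gap_rate:
  assumes n: "0 < n" and z: "outer_gap z \<le> outer_gap (x (int n))"
    "outer_gap z \<le> outer_gap (avg_iterate x (int n))"
  shows "outer_gap z \<le> (real_of_int a)\<^sup>2 * (\<beta>f + \<beta>\<sigma>) / 2 * (norm (x 0 - x'))\<^sup>2 / (real n + 1)"
proof -
  have "real n * outer_gap z \<le> (\<Sum>s = 1..n. outer_gap (x (int s)))"
    using convex_on_avg_iterate(2)[OF gaps_convex(2) n, of x] iterate_in_eff_dom z(2)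
      mult_left_mono[OF z(2), of "real n"] by simp
  then show ?thesis
    using outer_rate[where a = a and P = "\<lambda>n. inner_gap (x (int n))"
        and W = "\<lambda>n. outer_gap (x (int n))"
        and U = "\<lambda>n. (real_of_int a)\<^sup>2 * (\<beta>f + \<beta>\<sigma>) / 2 * (norm (offset (int n)))\<^sup>2", OF _ _ _ scaled_step n z(1)]
      a inner_gap_nonneg iterate_in_eff_dom smoothness_sum_nonneg offset_0 by simp
qed

lemma inner_gap_rate:
  assumes n: "0 < n" and z: "z \<in> {x (int n), avg_iterate x (int n)}"
    and D: "0 \<le> D" "\<And>w. w \<in> eff_dom \<Longrightarrow> - D \<le> outer_gap w"
  shows "real n * inner_gap z
    \<le> pi\<^sup>2 / 6 * ((real_of_int a)\<^sup>2 * (\<beta>f + \<beta>\<sigma>) / 2 * (norm (x 0 - x'))\<^sup>2) + (real_of_int a)\<^sup>2 * ln (real n + 1) * D"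
proof -
  have "inner_gap z \<le> inner_gap (x (int n))
      \<or> real n * inner_gap z \<le> (\<Sum>s = 1..n. inner_gap (x (int s)))"
    using convex_on_avg_iterate(2)[OF gaps_convex(1) n, of x] iterate_in_eff_dom z by auto
  then show ?thesis
    using inner_rate[where a = a and P = "\<lambda>n. inner_gap (x (int n))"
        and W = "\<lambda>n. outer_gap (x (int n))"
        and U = "\<lambda>n. (real_of_int a)\<^sup>2 * (\<beta>f + \<beta>\<sigma>) / 2 * (norm (offset (int n)))\<^sup>2", OF _ _ _ scaled_step n _ D(1)]
      a inner_gap_nonneg iterate_in_eff_dom smoothness_sum_nonneg offset_0 D(2) by simp
qed

end

theorem theorem3:
  fixes f \<sigma> :: "real ^ 'n \<Rightarrow> real" and g \<psi> \<phi> \<omega> :: "real ^ 'n \<Rightarrow> ereal"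
    and \<beta>f \<beta>\<sigma> \<beta> :: real and \<omega>star :: ereal and a :: int and x xt :: "int \<Rightarrow> real ^ 'n"
  defines "\<phi> \<equiv> composite f g" and "\<omega> \<equiv> composite \<sigma> \<psi>"
    and "\<beta> \<equiv> \<beta>f + \<beta>\<sigma>" and "\<omega>star \<equiv> (INF z. \<omega> z)"
  assumes "convex_on UNIV f" and "smooth_with \<beta>f f"
    and "convex_on UNIV \<sigma>" and "smooth_with \<beta>\<sigma> \<sigma>"
    and "\<beta> > 0"
    and "proper_fun g" and "lsc_fun g" and "convex_fun g"
    and "proper_fun \<psi>" and "lsc_fun \<psi>" and "convex_fun \<psi>"
    and "inner_solutions \<phi> \<noteq> {}"
    and "\<omega>star > - \<infinity>"
    and "a \<ge> 2"
    and "fbipg_sequence f g \<sigma> \<psi> \<beta> 1 a x"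
    and "\<forall>k\<ge>1. is_arg_min \<omega> (\<lambda>z. z \<in> {x k, avg_iterate x k}) (xt k)"
  shows "\<forall>k\<ge>1. \<forall>x' \<in> outer_solutions \<phi> \<omega>.
      \<phi> (xt k) - \<phi> x' \<le>
        ereal (pi\<^sup>2 * (real_of_int a)\<^sup>2 * \<beta> / (12 * real_of_int k) * (norm (x 0 - x'))\<^sup>2)
        + ereal ((real_of_int a)\<^sup>2 * ln (real_of_int k + 1) / real_of_int k) * (\<omega> x' - \<omega>star)
    \<and> \<omega> (xt k) - \<omega> x' \<le>
        ereal ((real_of_int a)\<^sup>2 * \<beta> / (2 * (real_of_int k + 1)) * (norm (x 0 - x'))\<^sup>2)"
proof (intro allI impI ballI)
  fix k :: int and x'
  assume k: "1 \<le> k" and x': "x' \<in> outer_solutions \<phi> \<omega>"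
  have x'_min: "\<phi> x' \<le> \<phi> z" for z
    using x' by (simp add: outer_solutions_def inner_solutions_def is_arg_min_linorder)
  have g_x': "g x' \<noteq> \<infinity>"
  proof -
    obtain z where "g z \<noteq> \<infinity>" using assms(10) by (auto simp: proper_fun_def)
    then show ?thesis
      using x'_min[of z] unfolding \<phi>_def composite_def by (cases "g z") auto
  qed
  have \<psi>_x': "\<psi> x' \<noteq> \<infinity>"
    using x' unfolding outer_solutions_def \<omega>_def composite_def by auto
  interpret fbipg_run f \<sigma> g \<psi> \<beta>f \<beta>\<sigma> a x x'
    using assms x'_min g_x' \<psi>_x' by unfold_locales auto
  define n where "n = nat k"
  have n: "0 < n" "k = int n" using k by (auto simp: n_def)
  have xt: "xt k \<in> {x (int n), avg_iterate x (int n)}"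
    and xt_min: "\<omega> (xt k) \<le> \<omega> (x (int n))" "\<omega> (xt k) \<le> \<omega> (avg_iterate x (int n))"
    using assms(20) k n(2) by (auto simp: is_arg_min_linorder)
  have xt_eff_dom: "xt k \<in> eff_dom" by (rule candidate_in_eff_dom[OF n(1) xt])
  have gaps: "\<phi> z - \<phi> x' = ereal (inner_gap z)" "\<omega> z - \<omega> x' = ereal (outer_gap z)" if "z \<in> eff_dom" for z
    using composite_on_eff_dom[OF that] composite_on_eff_dom[OF x'_in_eff_dom]
    by (simp_all add: \<phi>_def \<omega>_def inner_gap_def outer_gap_def)
  obtain w where w: "\<omega>star = ereal w"
  proof -
    have "\<omega>star \<le> \<omega> x'" unfolding \<omega>star_def by (rule INF_lower) simp
    then show ?thesis
      using that assms(17) composite_on_eff_dom(2)[OF x'_in_eff_dom] unfolding \<omega>_def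
      by (cases \<omega>star) auto
  qed
  define D where "D = \<sigma> x' + real_of_ereal (\<psi> x') - w"
  have D: "\<omega> x' - \<omega>star = ereal D"
    using composite_on_eff_dom(2)[OF x'_in_eff_dom] by (simp add: \<omega>_def w D_def)
  have D_bound: "- D \<le> outer_gap z" if "z \<in> eff_dom" for z
  proof -
    have "\<omega>star \<le> \<omega> z" unfolding \<omega>star_def by (rule INF_lower) simp
    then show ?thesis
      using composite_on_eff_dom(2)[OF that] by (simp add: \<omega>_def w D_def outer_gap_def)
  qed
  have D_nonneg: "0 \<le> D" using D_bound[OF x'_in_eff_dom] by (simp add: outer_gap_def)
  have outer_min: "outer_gap (xt k) \<le> outer_gap z"
    if "z \<in> {x (int n), avg_iterate x (int n)}" for z
    using that xt_min composite_on_eff_dom(2)[OF candidate_in_eff_dom[OF n(1) that]] composite_on_eff_dom(2)[OF xt_eff_dom]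
    by (auto simp: \<omega>_def outer_gap_def)
  have "inner_gap (xt k) \<le> (pi\<^sup>2 / 6 * ((real_of_int a)\<^sup>2 * \<beta> / 2 * (norm (x 0 - x'))\<^sup>2) + (real_of_int a)\<^sup>2 * ln (real n + 1) * D) / real n"
    using inner_gap_rate[OF n(1) xt D_nonneg D_bound] n(1)
    by (simp add: \<beta>_def pos_le_divide_eq mult.commute[of _ "real n"])
  also have "\<dots> = pi\<^sup>2 * (real_of_int a)\<^sup>2 * \<beta> / (12 * real_of_int k) * (norm (x 0 - x'))\<^sup>2
      + (real_of_int a)\<^sup>2 * ln (real_of_int k + 1) / real_of_int k * D"
    by (simp add: n(2) add_divide_distrib)
  finally have "inner_gap (xt k) \<le> pi\<^sup>2 * (real_of_int a)\<^sup>2 * \<beta> / (12 * real_of_int k) * (norm (x 0 - x'))\<^sup>2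
      + (real_of_int a)\<^sup>2 * ln (real_of_int k + 1) / real_of_int k * D" .
  moreover have "outer_gap (xt k)
      \<le> (real_of_int a)\<^sup>2 * \<beta> / (2 * (real_of_int k + 1)) * (norm (x 0 - x'))\<^sup>2"
    using outer_gap_rate[OF n(1) outer_min outer_min] by (simp add: \<beta>_def n(2))
  ultimately show "\<phi> (xt k) - \<phi> x' \<le>
        ereal (pi\<^sup>2 * (real_of_int a)\<^sup>2 * \<beta> / (12 * real_of_int k) * (norm (x 0 - x'))\<^sup>2)
        + ereal ((real_of_int a)\<^sup>2 * ln (real_of_int k + 1) / real_of_int k) * (\<omega> x' - \<omega>star)
    \<and> \<omega> (xt k) - \<omega> x' \<le>
        ereal ((real_of_int a)\<^sup>2 * \<beta> / (2 * (real_of_int k + 1)) * (norm (x 0 - x'))\<^sup>2)"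
    unfolding gaps[OF xt_eff_dom] D by simp
qed

end
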